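(* Consider the exploration problem on a weighted tree where the predictions satisfy $(1-\varepsilon)d_G(v,g)\le f(v)\le(1+\varepsilon)d_G(v,g)$ for all vertices $v$, for some $\varepsilon\in(0,1)$, and $\varepsilon$ is known to the searcher. Then there exists an algorithm which succeeds in finding the goal $g$ and satisfies $$\mathrm{ALG}\le\Big(\frac{1}{1-\varepsilon}+n\varepsilon\cdot\frac{4}{(1-\varepsilon)^2}\Big)\mathrm{OPT}.$$ Moreover, if the predictions are admissible (i.e. $f(v)\le d_G(v,g)$ for all $v$), the same algorithm satisfies $\mathrm{ALG}\le\big(1+n\varepsilon\cdot\frac{2}{1-\varepsilon}\big)\mathrm{OPT}$.
   Context: Exploration setting on a tree: $G=(V,E)$ is a finite undirected tree with positive edge weights, $n=|V|$, and $d_G$ is the weighted shortest-path distance. An agent starts at root $r\in V$ and must reach an unknown goal $g\in V$, recognized upon visiting. Predictions $f:V\to\mathbb{R}$ are available only at observed vertices. For $S\subseteq V$, $\partial S$ is the set of vertices outside $S$ adjacent to some vertex of $S$. Having visited $V_{i-1}$ ($V_0=\{r\}$), at iteration $i$ the agent knows only the subgraph $G_i$ with vertex set $V_{i-1}\cup\partial V_{i-1}$ and all edges incident to $V_{i-1}$, with the predictions there; it moves to some $v_i\in\partial V_{i-1}$ paying $d_{G_i}(v_{i-1},v_i)$. $\mathrm{ALG}$ is the total distance travelled until $g$ is visited and $\mathrm{OPT}=d_G(r,g)$. *)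

theory Defs
  imports Graph_Theory.Shortest_Path Graph_Theory.Digraph_Component
begin

text \<open>
  An undirected simple graph is a finite, symmetric, loop-free digraph \<^locale>\<open>pair_graph\<close>.
  Every edge then yields the directed cycle \<open>a, b, a\<close>, so the constant \<open>tree\<close> of
  \<^theory>\<open>Graph_Theory.Digraph_Component\<close> does not describe undirected trees: the cycles of the
  undirected graph are the directed ones with at least three arcs.
\<close>

locale weighted_tree = pair_graph G
  for G :: "'a pair_pre_digraph" +
  fixes w :: "'a \<times> 'a \<Rightarrow> real"
  assumes connected_graph: "connected (with_proj G)"
    and no_undirected_cycle: "\<not> (\<exists>p. cycle p \<and> 3 \<le> length p)"
    and weight_pos: "(u, v) \<in> parcs G \<Longrightarrow> 0 < w (u, v)"
    and weight_sym: "(u, v) \<in> parcs G \<Longrightarrow> w (u, v) = w (v, u)"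

text \<open>
  The library distance \<open>\<mu>\<close> is extended-real valued. It is finite between vertices joined by a walk,
  and only such pairs of vertices matter below.
\<close>

definition graph_dist :: "'a pair_pre_digraph \<Rightarrow> ('a \<times> 'a \<Rightarrow> real) \<Rightarrow> 'a \<Rightarrow> 'a \<Rightarrow> real" where
  "graph_dist G w u v = real_of_ereal (wf_digraph.\<mu> (with_proj G) w u v)"

definition boundary :: "'a pair_pre_digraph \<Rightarrow> 'a set \<Rightarrow> 'a set" where
  "boundary G S = {v \<in> pverts G - S. \<exists>u \<in> S. (u, v) \<in> parcs G}"

definition observed_graph :: "'a pair_pre_digraph \<Rightarrow> 'a set \<Rightarrow> 'a pair_pre_digraph" where
  "observed_graph G S =
    \<lparr> pverts = S \<union> boundary G S, parcs = {(u, v) \<in> parcs G. u \<in> S \<or> v \<in> S} \<rparr>"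

text \<open>
  Everything the searcher knows before a move: the vertices visited so far in order (the first is
  the root, the last the current position), the observed subgraph, its edge weights, and the
  predictions at its vertices. The last two are partial maps, undefined on unobserved edges and
  vertices. Views of earlier iterations can be recovered from the current one.
\<close>

record 'a view =
  visited :: "'a list"
  known_graph :: "'a pair_pre_digraph"
  known_weight :: "'a \<times> 'a \<rightharpoonup> real"
  known_prediction :: "'a \<rightharpoonup> real"

definition view_of ::
  "'a pair_pre_digraph \<Rightarrow> ('a \<times> 'a \<Rightarrow> real) \<Rightarrow> ('a \<Rightarrow> real) \<Rightarrow> 'a list \<Rightarrow> 'a view" where
  "view_of G w f xs =
    (let H = observed_graph G (set xs) in
      \<lparr> visited = xs, known_graph = H,
        known_weight = (Some \<circ> w) |` parcs H,
        known_prediction = (Some \<circ> f) |` pverts H \<rparr>)"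

type_synonym 'a algorithm = "'a view \<Rightarrow> 'a"

text \<open>
  \<open>visits A G w f r i\<close> is the list \<open>[v\<^sub>0, \<dots>, v\<^sub>i]\<close> with \<open>v\<^sub>0 = r\<close>. It ignores the goal; what
  happens after the first visit to the goal is discarded in \<open>finds_goal_at\<close>.
\<close>

primrec visits ::
  "'a algorithm \<Rightarrow> 'a pair_pre_digraph \<Rightarrow> ('a \<times> 'a \<Rightarrow> real) \<Rightarrow> ('a \<Rightarrow> real) \<Rightarrow> 'a
    \<Rightarrow> nat \<Rightarrow> 'a list" where
  "visits A G w f r 0 = [r]"
| "visits A G w f r (Suc i) =
    visits A G w f r i @ [A (view_of G w f (visits A G w f r i))]"

definition position ::
  "'a algorithm \<Rightarrow> 'a pair_pre_digraph \<Rightarrow> ('a \<times> 'a \<Rightarrow> real) \<Rightarrow> ('a \<Rightarrow> real) \<Rightarrow> 'a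
    \<Rightarrow> nat \<Rightarrow> 'a" where
  "position A G w f r i = last (visits A G w f r i)"

definition finds_goal_at ::
  "'a algorithm \<Rightarrow> 'a pair_pre_digraph \<Rightarrow> ('a \<times> 'a \<Rightarrow> real) \<Rightarrow> ('a \<Rightarrow> real) \<Rightarrow> 'a \<Rightarrow> 'a
    \<Rightarrow> nat \<Rightarrow> bool" where
  "finds_goal_at A G w f r g T \<longleftrightarrow>
    position A G w f r T = g \<and>
    (\<forall>i<T. position A G w f r i \<noteq> g) \<and>
    (\<forall>i<T. position A G w f r (Suc i) \<in> boundary G (set (visits A G w f r i)))"

definition travel_cost ::
  "'a algorithm \<Rightarrow> 'a pair_pre_digraph \<Rightarrow> ('a \<times> 'a \<Rightarrow> real) \<Rightarrow> ('a \<Rightarrow> real) \<Rightarrow> 'a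
    \<Rightarrow> nat \<Rightarrow> real" where
  "travel_cost A G w f r T =
    (\<Sum>i<T. graph_dist (observed_graph G (set (visits A G w f r i))) w
              (position A G w f r i) (position A G w f r (Suc i)))"

end

theory Submission
  imports Defs
begin

text \<open>
  Let \<open>d\<close> be the distance in the tree, \<open>r\<close> the root, \<open>g\<close> the goal and \<open>OPT = d r g\<close>. From the
  position \<open>x\<close> the searcher moves to the boundary vertex minimising \<open>d x v + f v\<close> among those with
  \<open>d r v + f v / (1 + \<epsilon>) \<le> f r / (1 - \<epsilon>)\<close>. The boundary vertex \<open>u\<close> through which every path from
  the visited set to \<open>g\<close> leaves passes this filter, since \<open>d r u + d u g = OPT\<close>. Comparing the
  chosen \<open>v\<close> with \<open>u\<close> gives \<open>d x v \<le> d x g - d v g + \<epsilon> * (d u g + d v g)\<close>. Here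
  \<open>d u g \<le> OPT\<close>, and the filter together with \<open>d v g \<le> d r v + OPT\<close> forces
  \<open>d v g \<le> (1 + \<epsilon>) / (1 - \<epsilon>) * OPT\<close>, so the error of a step is at most
  \<open>2 * \<epsilon> / (1 - \<epsilon>) * OPT\<close>. Summing over at most \<open>n\<close> steps telescopes to
  \<open>ALG \<le> (1 + n * \<epsilon> * 2 / (1 - \<epsilon>)) * OPT\<close>, which lies below both claimed bounds.
\<close>

section \<open>Distances as costs of walks\<close>

context pair_fin_digraph
begin

text \<open>\<open>real_of_ereal\<close> sends both infinities to 0, so the inequality transfers to
  the reals only because \<open>\<mu>\<close> is finite: nonnegative weights bound it below, the
  walk bounds it above.\<close>

lemma graph_dist_le_awalk_cost:
  assumes "\<And>e. e \<in> parcs G \<Longrightarrow> 0 \<le> w e" and "awalk u p v"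
  shows "graph_dist G w u v \<le> awalk_cost w p"
proof -
  have "\<mu> w u v \<le> awalk_cost w p" using assms(2) by (rule min_cost_le_walk_cost)
  moreover have "0 \<le> \<mu> w u v"
    unfolding \<mu>_def using assms(1) by (auto intro!: INF_greatest pos_cost_pos_awalk_cost)
  ultimately show ?thesis unfolding graph_dist_def by (cases "\<mu> w u v") auto
qed

lemma graph_dist_eq_apath_cost:
  assumes "\<And>e. e \<in> parcs G \<Longrightarrow> 0 \<le> w e" and "awalk u q v"
  obtains p where "apath u p v" "graph_dist G w u v = awalk_cost w p"
proof -
  have "u \<rightarrow>\<^sup>*\<^bsub>G\<^esub> v" using assms(2) by (rule reachable_awalkI)
  then obtain p where "apath u p v" "\<mu> w u v = awalk_cost w p"
    using min_cost_awalk[of u v w] assms(1) by auto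
  then show thesis using that by (simp add: graph_dist_def)
qed

end

text \<open>Needed because the searcher's weight function, obtained by \<open>the\<close> from a
  partial map, agrees with \<open>w\<close> on observed arcs only.\<close>

lemma graph_dist_cong:
  assumes "wf_digraph (with_proj G)" and "\<And>e. e \<in> parcs G \<Longrightarrow> w e = w' e"
  shows "graph_dist G w u v = graph_dist G w' u v"
proof -
  interpret wf_digraph "with_proj G" by fact
  have "awalk_cost w p = awalk_cost w' p" if "awalk u p v" for p
  proof -
    have "set p \<subseteq> parcs G" using that by (auto simp: awalk_def)
    then have "map w p = map w' p" using assms(2) by (intro map_cong) auto
    then show ?thesis by (simp only: awalk_cost_def)
  qed
  then show ?thesis by (simp add: graph_dist_def \<mu>_def)
qed

section \<open>Cutting walks at a vertex set\<close>

context pair_wf_digraph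
begin

lemma awalk_first_entry:
  assumes "awalk u p v" and "v \<in> Q"
  shows "\<exists>p1 p2 z. p = p1 @ p2 \<and> awalk u p1 z \<and> awalk z p2 v \<and> z \<in> Q \<and> set (pawalk_verts u p1) \<inter> Q = {z}"
  using assms
proof (induction p arbitrary: u)
  case Nil
  then show ?case by (auto simp: awalk_Nil_iff)
next
  case (Cons e p)
  show ?case
  proof (cases "u \<in> Q")
    case True
    then show ?thesis using Cons.prems
      by (intro exI[of _ "[]"] exI[of _ "e # p"] exI[of _ u]) (auto simp: awalk_Nil_iff)
  next
    case False
    have e: "e \<in> parcs G" "fst e = u" "awalk (snd e) p v"
      using Cons.prems by (auto simp: awalk_Cons_iff)
    from Cons.IH[OF e(3) Cons.prems(2)] obtain p1 p2 z where p: "p = p1 @ p2"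
      "awalk (snd e) p1 z" "awalk z p2 v" "z \<in> Q" "set (pawalk_verts (snd e) p1) \<inter> Q = {z}"
      by (elim exE conjE)
    have "awalk u (e # p1) z" using e p(2) by (simp add: awalk_Cons_iff)
    moreover have "set (pawalk_verts u (e # p1)) \<inter> Q = {z}" using e(2) False p(5) by auto
    ultimately show ?thesis using p(1,3,4)
      by (intro exI[of _ "e # p1"] exI[of _ p2] exI[of _ z]) simp
  qed
qed

text \<open>The last exit is taken rather than the first so that the remaining walk avoids
  \<open>S\<close> altogether and can be glued to a path inside \<open>S\<close> without repeating a
  vertex.\<close>

lemma awalk_last_exit:
  assumes "awalk u p v" and "set (pawalk_verts u p) \<inter> S \<noteq> {}" and "v \<notin> S"
  shows "\<exists>p1 y z p2. p = p1 @ (y, z) # p2 \<and> y \<in> S \<and> set (pawalk_verts z p2) \<inter> S = {}"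
  using assms
proof (induction p arbitrary: u)
  case Nil
  then show ?case by (auto simp: awalk_Nil_iff)
next
  case (Cons e p)
  have e: "e \<in> parcs G" "fst e = u" "awalk (snd e) p v"
    using Cons.prems by (auto simp: awalk_Cons_iff)
  show ?case
  proof (cases "set (pawalk_verts (snd e) p) \<inter> S = {}")
    case True
    then show ?thesis using Cons.prems(2)
      by (intro exI[of _ "[]"] exI[of _ "fst e"] exI[of _ "snd e"] exI[of _ p]) auto
  next
    case False
    then obtain p1 y z p2 where "p = p1 @ (y, z) # p2" "y \<in> S" "set (pawalk_verts z p2) \<inter> S = {}"
      using Cons.IH[OF e(3)] Cons.prems(3) by blast
    then show ?thesis by (intro exI[of _ "e # p1"]) auto
  qed
qed

end

section \<open>Unique paths and the tree metric\<close>

context weighted_tree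
begin

lemma weight_nonneg: "e \<in> parcs G \<Longrightarrow> 0 \<le> w e"
  using weight_pos[of "fst e" "snd e"] by simp

text \<open>
  If the paths already differ in their first arc, then following the first one until it meets the
  second and returning along the second is a cycle. It has at least three arcs because the first
  arcs have different heads.
\<close>

lemma apath_unique:
  assumes "apath u p v" and "apath u q v"
  shows "p = q"
  using assms
proof (induction p arbitrary: u q)
  case Nil
  then show ?case using apath_nonempty_ends by (metis apath_Nil_iff)
next
  case (Cons e p)
  have "q \<noteq> []" using Cons.prems apath_nonempty_ends by (metis apath_Nil_iff list.distinct(1))
  then obtain e' q' where q: "q = e' # q'" by (cases q) auto
  have e: "e \<in> parcs G" "fst e = u" "apath (snd e) p v" "u \<notin> set (pawalk_verts (snd e) p)"
    using Cons.prems(1) by (auto simp: apath_Cons_iff)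
  have e': "e' \<in> parcs G" "fst e' = u" "apath (snd e') q' v" "u \<notin> set (pawalk_verts (snd e') q')"
    using Cons.prems(2) q by (auto simp: apath_Cons_iff)
  show ?case
  proof (cases "snd e = snd e'")
    case True
    then have "e = e'" using e(2) e'(2) by (simp add: prod_eq_iff)
    then show ?thesis using Cons.IH[of "snd e" q'] e(3) e'(3) q by simp
  next
    case False
    let ?Q = "set (pawalk_verts (snd e') q')"
    have "v \<in> ?Q" using e'(3) by (auto simp: apath_def)
    then obtain p1 p2 z where p: "p = p1 @ p2" "awalk (snd e) p1 z" "awalk z p2 v" "z \<in> ?Q"
      "set (pawalk_verts (snd e) p1) \<inter> ?Q = {z}"
      using awalk_first_entry[of "snd e" p v ?Q] e(3) by (auto simp: apath_def)
    obtain q1 q2 where q': "q' = q1 @ q2" "awalk (snd e') q1 z" "awalk z q2 v"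
      using awalk_decomp[of "snd e'" q' v z] e'(3) p(4) by (auto simp: apath_def)
    have dp: "distinct (pawalk_verts (snd e) p1)" "u \<notin> set (pawalk_verts (snd e) p1)"
      using e(3,4) p(1,2) by (auto simp: apath_append_iff apath_def awalk_verts_append)
    have "set (pawalk_verts (snd e') q1) \<subseteq> ?Q"
      using q' set_awalk_verts_append[OF q'(2,3)] by auto
    have dq: "distinct (pawalk_verts (snd e') q1)"
      using e'(3) apath_append_iff[of "snd e'" q1 q2 v] q'(1,2) by (simp add: apath_def)
    have "awalk u (e' # q1) z" using q'(2) e'(1,2) by (simp add: awalk_Cons_iff)
    then have rev_walk: "awalk z (rev_path (e' # q1)) u"
      and rev_verts: "pawalk_verts z (rev_path (e' # q1)) = rev (pawalk_verts (snd e') q1) @ [u]"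
      using awalk_verts_rev_path[of u "e' # q1" z] e'(2)
      by (simp_all del: rev_path.simps)
    \<comment> \<open>\<open>z\<close> ends the outgoing piece and starts the returning one; one of
      its two copies is split off before the vertex lists are joined.\<close>
    obtain vs where vs: "rev (pawalk_verts (snd e') q1) = z # vs"
      using q'(2) by (cases "rev (pawalk_verts (snd e') q1)") (auto simp: hd_rev[symmetric])
    have walk: "awalk u (e # p1 @ rev_path (e' # q1)) u"
      using e(1,2) p(2) rev_walk awalk_appendI[OF p(2) rev_walk]
      by (simp add: awalk_Cons_iff del: rev_path.simps)
    have verts: "tl (pawalk_verts u (e # p1 @ rev_path (e' # q1))) =
        pawalk_verts (snd e) p1 @ vs @ [u]"
      using awalk_verts_append[OF awalk_appendI[OF p(2) rev_walk]] p(2) rev_verts vs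
      by (simp del: rev_path.simps)
    have vsQ: "set (z # vs) = set (pawalk_verts (snd e') q1)" "distinct (z # vs)"
      using dq by (simp_all flip: vs)
    \<comment> \<open>The outgoing piece meets \<open>?Q\<close> in \<open>z\<close> only,
      \<open>vs\<close> stays in \<open>?Q\<close> without \<open>z\<close>, and \<open>u\<close>
      lies on neither piece.\<close>
    have "distinct (pawalk_verts (snd e) p1 @ vs @ [u])"
      using dp vsQ p(5) e'(4) \<open>set (pawalk_verts (snd e') q1) \<subseteq> ?Q\<close> by auto
    then have "cycle (e # p1 @ rev_path (e' # q1))"
      unfolding cycle_def using walk verts by (metis list.distinct(1))
    moreover have "p1 \<noteq> [] \<or> q1 \<noteq> []"
      using False p(2) q'(2) by (auto simp: awalk_Nil_iff)
    then have "3 \<le> length (e # p1 @ rev_path (e' # q1))"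
      by (cases p1; cases q1) auto
    ultimately show ?thesis using no_undirected_cycle by blast
  qed
qed

lemma vertices_reachable:
  assumes "u \<in> pverts G" and "v \<in> pverts G"
  shows "u \<rightarrow>\<^sup>*\<^bsub>G\<^esub> v"
proof -
  have "u \<rightarrow>\<^sup>*\<^bsub>mk_symmetric G\<^esub> v"
    using connected_graph assms unfolding connected_def strongly_connected_def by auto
  then show ?thesis using reachable_mk_symmetric_eq[OF pair_sym_arcs] by simp
qed

text \<open>The minimum is attained on a simple path, and there is only one. Computing a distance
  thus reduces to exhibiting a simple path.\<close>

lemma graph_dist_apath:
  assumes "apath u p v"
  shows "graph_dist G w u v = awalk_cost w p"
proof -
  obtain q where "apath u q v" "graph_dist G w u v = awalk_cost w q"
    using graph_dist_eq_apath_cost[of w u p v, OF weight_nonneg awalkI_apath[OF assms]] by blast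
  then show ?thesis using apath_unique[OF assms] by simp
qed

lemma graph_dist_nonneg:
  assumes "u \<in> pverts G" and "v \<in> pverts G"
  shows "0 \<le> graph_dist G w u v"
proof -
  obtain p where p: "apath u p v"
    using vertices_reachable[OF assms] by (meson reachable_apath)
  then show ?thesis
    using graph_dist_apath pos_cost_pos_awalk_cost[OF awalkI_apath[OF p] weight_nonneg] by simp
qed

lemma graph_dist_triangle:
  assumes "u \<in> pverts G" and "x \<in> pverts G" and "v \<in> pverts G"
  shows "graph_dist G w u v \<le> graph_dist G w u x + graph_dist G w x v"
proof -
  obtain p q where "apath u p x" "apath x q v"
    using vertices_reachable assms by (meson reachable_apath)
  then show ?thesis
    using graph_dist_apath graph_dist_le_awalk_cost[of w u "p @ q" v, OF weight_nonneg]
      awalk_appendI[of u p x q v] by (simp add: apath_def)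
qed

lemma graph_dist_commute:
  assumes "u \<in> pverts G" and "v \<in> pverts G"
  shows "graph_dist G w u v = graph_dist G w v u"
proof -
  obtain p where p: "apath u p v"
    using vertices_reachable assms by (meson reachable_apath)
  have "awalk_cost w (rev_path p) = awalk_cost w p" if "set p \<subseteq> parcs G" for p
    using that
  proof (induction p)
    case (Cons e p)
    then have "w (snd e, fst e) = w e" using weight_sym[of "fst e" "snd e"] by simp
    then show ?case using Cons by simp
  qed simp
  moreover have "set p \<subseteq> parcs G" using p by (auto simp: apath_def)
  ultimately show ?thesis using p graph_dist_apath[of u p v] graph_dist_apath[of v "rev_path p" u]
    by simp
qed

section \<open>Subtrees and the graph observed from them\<close>

text \<open>These are the vertex sets of subtrees, together with the empty set. The visited set
  stays of this form throughout the search.\<close>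

definition path_closed :: "'a set \<Rightarrow> bool" where
  "path_closed S \<longleftrightarrow> S \<subseteq> pverts G \<and>
    (\<forall>x\<in>S. \<forall>y\<in>S. \<exists>p. apath x p y \<and> set (pawalk_verts x p) \<subseteq> S)"

lemma path_closed_subset: "path_closed S \<Longrightarrow> S \<subseteq> pverts G"
  by (simp add: path_closed_def)

lemma path_closed_singleton: "r \<in> pverts G \<Longrightarrow> path_closed {r}"
  unfolding path_closed_def by (auto simp: apath_Nil_iff intro!: exI[of _ "[]"])

text \<open>A path inside \<open>S\<close> to a neighbour of \<open>u\<close> is extended by one
  arc. Each of its arcs starts in \<open>S\<close> and is therefore observed.\<close>

lemma boundary_path:
  assumes "path_closed S" and "x \<in> S" and "u \<in> boundary G S"
  obtains p where "apath x p u" "set (pawalk_verts x p) \<subseteq> insert u S" "set p \<subseteq> parcs (observed_graph G S)"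
proof -
  obtain y where y: "y \<in> S" "(y, u) \<in> parcs G" "u \<notin> S" "u \<in> pverts G"
    using assms(3) by (auto simp: boundary_def)
  obtain p where p: "apath x p y" "set (pawalk_verts x p) \<subseteq> S"
    using assms(1,2) y(1) unfolding path_closed_def by blast
  have "fst ` set p \<subseteq> S" using p(2) awalk_verts_arc1 by blast
  moreover have "set p \<subseteq> parcs G" using p(1) by (auto simp: apath_def)
  ultimately have "set (p @ [(y, u)]) \<subseteq> parcs (observed_graph G S)"
    using y by (auto simp: observed_graph_def)
  moreover have "apath x (p @ [(y, u)]) u"
  proof -
    have "last (pawalk_verts x p) = y" using p(1) by (auto simp: apath_def)
    moreover have "apath y [(y, u)] u" using y in_arcsD1 by (auto simp: apath_simps)
    ultimately show ?thesis using p y by (auto simp: apath_append_iff)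
  qed
  moreover have "set (pawalk_verts x (p @ [(y, u)])) \<subseteq> insert u S"
    using set_awalk_verts_append[of x p y "[(y, u)]" u] p y
    by (auto simp: apath_def awalk_simps)
  ultimately show thesis using that by blast
qed

lemma path_closed_insert:
  assumes "path_closed S" and "u \<in> boundary G S"
  shows "path_closed (insert u S)"
proof -
  have u: "u \<in> pverts G" using assms(2) by (auto simp: boundary_def)
  have *: "\<exists>p. apath x p u \<and> set (pawalk_verts x p) \<subseteq> insert u S" if "x \<in> S" for x
    using boundary_path[OF assms(1) that assms(2)] by metis
  have "\<exists>p. apath u p x \<and> set (pawalk_verts u p) \<subseteq> insert u S" if x: "x \<in> S" for x
  proof -
    obtain p where "apath x p u" "set (pawalk_verts x p) \<subseteq> insert u S" using *[OF x] by blast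
    then show ?thesis
      by (intro exI[of _ "rev_path p"]) (auto simp: awalk_verts_rev_path apath_def)
  qed
  moreover have "\<exists>p. apath u p u \<and> set (pawalk_verts u p) \<subseteq> insert u S"
    using u by (intro exI[of _ "[]"]) (simp add: apath_Nil_iff)
  ultimately have "\<exists>p. apath x p y \<and> set (pawalk_verts x p) \<subseteq> insert u S"
    if "x \<in> insert u S" "y \<in> insert u S" for x y
  proof (cases "x = u \<or> y = u")
    case False
    then have "x \<in> S" "y \<in> S" using that by auto
    then show ?thesis using assms(1) unfolding path_closed_def by (meson subset_insertI2)
  qed (use that * in blast)
  then show ?thesis using path_closed_subset[OF assms(1)] u unfolding path_closed_def by blast
qed

lemma pair_fin_digraph_observed_graph:
  assumes "S \<subseteq> pverts G"
  shows "pair_fin_digraph (observed_graph G S)"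
proof
  have "pverts (observed_graph G S) \<subseteq> pverts G" "parcs (observed_graph G S) \<subseteq> parcs G"
    using assms by (auto simp: observed_graph_def boundary_def)
  then show "finite (pverts (observed_graph G S))" "finite (parcs (observed_graph G S))"
    using pair_finite_verts pair_finite_arcs by (auto intro: finite_subset)
next
  fix e assume e: "e \<in> parcs (observed_graph G S)"
  obtain a b where ab: "e = (a, b)" by (cases e)
  have "(a, b) \<in> parcs G" "a \<in> S \<or> b \<in> S" using e ab by (auto simp: observed_graph_def)
  moreover from this have "(b, a) \<in> parcs G" "a \<in> pverts G" "b \<in> pverts G"
    using arcs_symmetric in_arcsD1 in_arcsD2 by blast+
  ultimately show "fst e \<in> pverts (observed_graph G S)" "snd e \<in> pverts (observed_graph G S)"
    unfolding ab observed_graph_def boundary_def by auto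
qed

text \<open>A shortest simple path in the observed graph is also a simple path of the tree, hence
  the unique one, so hidden arcs offer no shortcut.\<close>

lemma observed_graph_dist:
  assumes "path_closed S" and "x \<in> S" and "u \<in> boundary G S"
  shows "graph_dist (observed_graph G S) w x u = graph_dist G w x u"
proof -
  have S: "S \<subseteq> pverts G" using assms(1) by (rule path_closed_subset)
  interpret H: pair_fin_digraph "observed_graph G S"
    by (rule pair_fin_digraph_observed_graph) fact
  have sub: "parcs (observed_graph G S) \<subseteq> parcs G"
    by (auto simp: observed_graph_def)
  have x: "x \<in> pverts (observed_graph G S)" "x \<in> pverts G"
    using assms S by (auto simp: observed_graph_def)
  have nonneg: "0 \<le> w e" if "e \<in> parcs (observed_graph G S)" for e
    using that sub weight_nonneg by blast
  obtain p where p: "apath x p u" "set p \<subseteq> parcs (observed_graph G S)"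
    using boundary_path[OF assms] by metis
  then have "H.awalk x p u" using x by (auto simp: H.awalk_def apath_def awalk_def)
  then obtain q where q: "H.apath x q u"
      "graph_dist (observed_graph G S) w x u = H.awalk_cost w q"
    using H.graph_dist_eq_apath_cost[of w x p u] nonneg by blast
  have "apath x q u" using q(1) x sub
    by (auto simp: H.apath_def H.awalk_def apath_def awalk_def)
  then show ?thesis using q(2) graph_dist_apath
    by (simp add: awalk_cost_def H.awalk_cost_def)
qed

text \<open>Take \<open>u\<close> just after the last exit from \<open>S\<close> on a path from some
  \<open>s\<close> to \<open>g\<close>. The same \<open>u\<close> serves every \<open>x\<close> in
  \<open>S\<close>: a path to \<open>u\<close> with all other vertices in \<open>S\<close>, followed
  by the rest of the route outside \<open>S\<close>, is simple.\<close>

lemma exit_vertex: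
  assumes "path_closed S" and "S \<noteq> {}" and "g \<in> pverts G" and "g \<notin> S"
  obtains u where "u \<in> boundary G S"
    "\<And>x. x \<in> S \<Longrightarrow> graph_dist G w x u + graph_dist G w u g = graph_dist G w x g"
proof -
  obtain s where s: "s \<in> S" "s \<in> pverts G" using assms(2) path_closed_subset[OF assms(1)] by blast
  obtain p where p: "apath s p g" using vertices_reachable s(2) assms(3) by (meson reachable_apath)
  have "s \<in> set (pawalk_verts s p)" using p by (auto simp: hd_in_awalk_verts)
  then obtain p1 y u p2 where d: "p = p1 @ (y, u) # p2" "y \<in> S"
      "set (pawalk_verts u p2) \<inter> S = {}"
    using awalk_last_exit[OF awalkI_apath[OF p], of S] s(1) assms(4) by blast
  have u: "(y, u) \<in> parcs G" "apath u p2 g"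
    using p[unfolded d(1) apath_append_iff apath_Cons_iff] by auto
  have "u \<notin> S" using d(3) hd_in_awalk_verts(2)[OF u(2)] by blast
  then have ub: "u \<in> boundary G S" using u(1) d(2) in_arcsD2 by (auto simp: boundary_def)
  have "graph_dist G w x u + graph_dist G w u g = graph_dist G w x g" if x: "x \<in> S" for x
  proof -
    obtain q where q: "apath x q u" "set (pawalk_verts x q) \<subseteq> insert u S"
      using boundary_path[OF assms(1) x ub] by metis
    \<comment> \<open>\<open>u\<close> closes \<open>q\<close> and opens \<open>p2\<close>, so only
      the vertices of \<open>p2\<close> after \<open>u\<close> must be disjoint from
      \<open>q\<close>.\<close>
    have "pawalk_verts u p2 = u # tl (pawalk_verts u p2)"
      using u(2) by (cases p2) (auto simp: apath_def awalk_Cons_iff)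
    then have "u \<notin> set (tl (pawalk_verts u p2))" "set (tl (pawalk_verts u p2)) \<subseteq> set (pawalk_verts u p2)"
      using u(2) unfolding apath_def by (metis distinct.simps(2), metis set_subset_Cons)
    moreover have "last (pawalk_verts x q) = u" using q(1) by (auto simp: apath_def)
    ultimately have "apath x (q @ p2) g" using q u(2) d(3)
      by (auto simp: apath_append_iff)
    then show ?thesis using q(1) u(2) by (simp add: graph_dist_apath)
  qed
  with ub that show thesis by blast
qed

end

section \<open>The exploration rule\<close>

text \<open>\<open>is_arg_min\<close> compares values on \<open>S\<close> only, so the two
  predicates coincide and the choice operator returns the same minimiser, even among ties.\<close>

lemma arg_min_on_cong:
  assumes "\<And>x. x \<in> S \<Longrightarrow> f x = g x"
  shows "arg_min_on f S = arg_min_on g S"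
proof -
  have "is_arg_min f (\<lambda>x. x \<in> S) = is_arg_min g (\<lambda>x. x \<in> S)"
    using assms unfolding is_arg_min_def fun_eq_iff by metis
  then show ?thesis by (simp add: arg_min_on_def arg_min_def)
qed

text \<open>\<open>h v / (1 + \<epsilon>)\<close> is a certified lower bound on the distance from
  \<open>v\<close> to the goal, and \<open>h r / (1 - \<epsilon>)\<close> a certified upper bound on
  OPT. The filter discards only vertices that cannot lie on the path from \<open>r\<close> to the
  goal.\<close>

definition explore_step :: "real \<Rightarrow> 'a algorithm" where
  "explore_step \<epsilon> V =
    (let d = graph_dist (known_graph V) (\<lambda>e. the (known_weight V e));
         h = (\<lambda>v. the (known_prediction V v));
         r = hd (visited V)
      in arg_min_on (\<lambda>v. d (last (visited V)) v + h v)
          {v \<in> pverts (known_graph V) - set (visited V). d r v + h v / (1 + \<epsilon>) \<le> h r / (1 - \<epsilon>)})"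

context weighted_tree
begin

lemma explore_step_view_of:
  assumes "path_closed (set xs)" and "xs \<noteq> []"
  shows "explore_step \<epsilon> (view_of G w f xs) =
    arg_min_on (\<lambda>v. graph_dist G w (last xs) v + f v)
      {v \<in> boundary G (set xs). graph_dist G w (hd xs) v + f v / (1 + \<epsilon>) \<le> f (hd xs) / (1 - \<epsilon>)}"
proof -
  let ?S = "set xs"
  let ?H = "observed_graph G ?S"
  let ?V = "view_of G w f xs"
  interpret H: pair_fin_digraph ?H
    by (intro pair_fin_digraph_observed_graph path_closed_subset assms(1))
  have ends: "hd xs \<in> ?S" "last xs \<in> ?S" using assms(2) by auto
  have d: "graph_dist (known_graph ?V) (\<lambda>e. the (known_weight ?V e)) x v = graph_dist G w x v"
    if "x \<in> ?S" "v \<in> boundary G ?S" for x v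
    using graph_dist_cong[OF H.wf_digraph, of "\<lambda>e. the (known_weight ?V e)" w x v]
      observed_graph_dist[OF assms(1) that]
    by (simp add: view_of_def Let_def)
  have h: "the (known_prediction ?V v) = f v" if "v \<in> ?S \<union> boundary G ?S" for v
    using that by (auto simp: view_of_def Let_def observed_graph_def)
  have v: "visited ?V = xs" by (simp add: view_of_def Let_def)
  have b: "pverts (known_graph ?V) - ?S = boundary G ?S"
    by (auto simp: view_of_def Let_def observed_graph_def boundary_def)
  have C: "{v \<in> boundary G ?S. graph_dist (known_graph ?V) (\<lambda>e. the (known_weight ?V e)) (hd xs) v
        + the (known_prediction ?V v) / (1 + \<epsilon>) \<le> the (known_prediction ?V (hd xs)) / (1 - \<epsilon>)}
      = {v \<in> boundary G ?S. graph_dist G w (hd xs) v + f v / (1 + \<epsilon>) \<le> f (hd xs) / (1 - \<epsilon>)}"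
    by (intro Collect_cong conj_cong refl) (simp only: d h ends Un_iff simp_thms)
  show ?thesis
    using d[OF ends(2)] h by (simp only: explore_step_def Let_def v b C) (rule arg_min_on_cong, simp)
qed

end

section \<open>Cost of a single move\<close>

text \<open>Here \<open>a\<close>, \<open>b\<close>, \<open>D\<close> stand for the distances
  \<open>r\<close> to \<open>v\<close>, \<open>v\<close> to \<open>g\<close>, \<open>r\<close> to
  \<open>g\<close>, and \<open>h\<close>, \<open>h0\<close> for the predictions at \<open>v\<close>
  and \<open>r\<close>. Adding \<open>b \<le> a + D\<close> to the filter cancels \<open>a\<close>
  and leaves \<open>2 * b / (1 + \<epsilon>) \<le> 2 * D / (1 - \<epsilon>)\<close>.\<close>

lemma candidate_distance_bound:
  fixes \<epsilon> :: real
  assumes "0 < \<epsilon>" and "\<epsilon> < 1"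
    and "a + h / (1 + \<epsilon>) \<le> h0 / (1 - \<epsilon>)" and "(1 - \<epsilon>) * b \<le> h"
    and "h0 \<le> (1 + \<epsilon>) * D" and "b \<le> a + D"
  shows "b \<le> (1 + \<epsilon>) / (1 - \<epsilon>) * D"
proof -
  have "(1 - \<epsilon>) * b / (1 + \<epsilon>) \<le> h / (1 + \<epsilon>)" "h0 / (1 - \<epsilon>) \<le> (1 + \<epsilon>) * D / (1 - \<epsilon>)"
    using assms by (auto intro!: divide_right_mono)
  then have "b + (1 - \<epsilon>) * b / (1 + \<epsilon>) \<le> D + (1 + \<epsilon>) * D / (1 - \<epsilon>)"
    using assms by linarith
  moreover have "b + (1 - \<epsilon>) * b / (1 + \<epsilon>) = 2 * b / (1 + \<epsilon>)"
    using assms by (simp add: field_simps)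
  moreover have "D + (1 + \<epsilon>) * D / (1 - \<epsilon>) = 2 * D / (1 - \<epsilon>)"
    using assms by (simp add: field_simps)
  ultimately show ?thesis using assms by (simp add: field_simps)
qed

locale tree_search = weighted_tree G w
  for G :: "'a pair_pre_digraph" and w +
  fixes \<epsilon> :: real and f :: "'a \<Rightarrow> real" and g :: 'a
  assumes eps: "0 < \<epsilon>" "\<epsilon> < 1"
    and goal: "g \<in> pverts G"
    and prediction: "v \<in> pverts G \<Longrightarrow> (1 - \<epsilon>) * graph_dist G w v g \<le> f v"
      "v \<in> pverts G \<Longrightarrow> f v \<le> (1 + \<epsilon>) * graph_dist G w v g"
begin

lemma explore_step_progress:
  assumes "path_closed (set xs)" and "xs \<noteq> []" and "g \<notin> set xs"
  defines "v \<equiv> explore_step \<epsilon> (view_of G w f xs)"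
  shows "v \<in> boundary G (set xs)"
    and "graph_dist (observed_graph G (set xs)) w (last xs) v \<le>
      graph_dist G w (last xs) g - graph_dist G w v g + \<epsilon> * (2 / (1 - \<epsilon>)) * graph_dist G w (hd xs) g"
proof -
  let ?d = "graph_dist G w" and ?r = "hd xs" and ?x = "last xs"
  let ?C = "{v \<in> boundary G (set xs). ?d ?r v + f v / (1 + \<epsilon>) \<le> f ?r / (1 - \<epsilon>)}"
  have xr: "?r \<in> set xs" "?x \<in> set xs" using assms(2) by auto
  then have xrG: "?r \<in> pverts G" "?x \<in> pverts G" using path_closed_subset[OF assms(1)] by auto
  obtain u where u: "u \<in> boundary G (set xs)"
    "\<And>x. x \<in> set xs \<Longrightarrow> ?d x u + ?d u g = ?d x g"
    using exit_vertex[of "set xs" g] assms goal by auto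
  have uG: "u \<in> pverts G" using u(1) by (auto simp: boundary_def)
  have "f u / (1 + \<epsilon>) \<le> ?d u g"
    using prediction(2)[OF uG] eps by (simp add: field_simps)
  moreover have "?d ?r g \<le> f ?r / (1 - \<epsilon>)"
    using prediction(1)[OF xrG(1)] eps by (simp add: field_simps)
  ultimately have uC: "u \<in> ?C" using u(1) u(2)[OF xr(1)] by auto
  have fin: "finite ?C" using pair_finite_verts by (auto simp: boundary_def)
  have v: "v = arg_min_on (\<lambda>v. ?d ?x v + f v) ?C"
    unfolding v_def by (rule explore_step_view_of) fact+
  have vC: "v \<in> ?C" unfolding v using arg_min_if_finite(1)[OF fin] uC by blast
  then show vb: "v \<in> boundary G (set xs)" by simp
  then have vG: "v \<in> pverts G" by (auto simp: boundary_def)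
  have min: "?d ?x v + f v \<le> ?d ?x u + f u"
  proof -
    have "?C \<noteq> {}" using uC by (metis empty_iff)
    from arg_min_least[where f = "\<lambda>v. ?d ?x v + f v", OF fin this uC] show ?thesis
      by (simp only: v)
  qed
  have "?d v g \<le> ?d ?r v + ?d ?r g"
    using graph_dist_triangle[of v ?r g] graph_dist_commute[of v ?r] vG xrG goal by simp
  then have "?d v g \<le> (1 + \<epsilon>) / (1 - \<epsilon>) * ?d ?r g"
    using vC prediction(1)[OF vG] prediction(2)[OF xrG(1)]
    by (intro candidate_distance_bound[OF eps, of "?d ?r v" "f v" "f ?r"]) auto
  moreover have "?d u g \<le> ?d ?r g"
    using u(2)[OF xr(1)] graph_dist_nonneg[OF xrG(1) uG] by linarith
  ultimately have "\<epsilon> * (?d u g + ?d v g) \<le> \<epsilon> * (?d ?r g + (1 + \<epsilon>) / (1 - \<epsilon>) * ?d ?r g)"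
    using eps by (intro mult_left_mono) auto
  \<comment> \<open>The constant arises as \<open>1 + (1 + \<epsilon>) / (1 - \<epsilon>) = 2 / (1 -
    \<epsilon>)\<close>.\<close>
  also have "\<dots> = \<epsilon> * (2 / (1 - \<epsilon>)) * ?d ?r g"
    using eps by (simp add: field_simps)
  finally have "\<epsilon> * (?d u g + ?d v g) \<le> \<epsilon> * (2 / (1 - \<epsilon>)) * ?d ?r g" .
  \<comment> \<open>In the minimality inequality, \<open>f v\<close> is bounded below,
    \<open>f u\<close> above, and \<open>?d ?x u\<close> is replaced by
    \<open>?d ?x g - ?d u g\<close>.\<close>
  moreover have "?d ?x v \<le> ?d ?x g - ?d v g + \<epsilon> * (?d u g + ?d v g)"
    using min u(2)[OF xr(2)] prediction(1)[OF vG] prediction(2)[OF uG]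
    by (simp add: algebra_simps)
  ultimately show "graph_dist (observed_graph G (set xs)) w ?x v \<le>
      ?d ?x g - ?d v g + \<epsilon> * (2 / (1 - \<epsilon>)) * ?d ?r g"
    using observed_graph_dist[OF assms(1) xr(2) vb] by linarith
qed

section \<open>Telescoping and termination\<close>

text \<open>The distance from the current position to \<open>g\<close> acts as a potential: each
  move costs at most its decrease plus a fixed error. Since \<open>g\<close> is excluded only for
  \<open>j < i\<close>, the invariant still holds at the iteration that reaches
  \<open>g\<close>.\<close>

lemma visits_before_goal:
  assumes "r \<in> pverts G" and "\<And>j. j < i \<Longrightarrow> g \<notin> set (visits (explore_step \<epsilon>) G w f r j)"
  defines "xs \<equiv> visits (explore_step \<epsilon>) G w f r"
  shows "path_closed (set (xs i)) \<and> distinct (xs i) \<and> length (xs i) = Suc i \<and> hd (xs i) = r \<and>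
    (\<forall>j<i. last (xs (Suc j)) \<in> boundary G (set (xs j))) \<and>
    travel_cost (explore_step \<epsilon>) G w f r i + graph_dist G w (last (xs i)) g \<le>
      graph_dist G w r g + real i * (\<epsilon> * (2 / (1 - \<epsilon>)) * graph_dist G w r g)"
  using assms(2)
proof (induction i)
  case 0
  then show ?case using assms(1)
    by (simp add: xs_def travel_cost_def path_closed_singleton)
next
  case (Suc i)
  note IH = Suc.IH[OF Suc.prems[OF less_SucI]]
  define v where "v = explore_step \<epsilon> (view_of G w f (xs i))"
  have ne: "xs i \<noteq> []" using IH by auto
  have Suc_xs: "xs (Suc i) = xs i @ [v]" by (simp add: xs_def v_def)
  have gi: "g \<notin> set (xs i)" using Suc.prems[of i] by (simp add: xs_def)
  note step = explore_step_progress[OF _ ne gi, folded v_def]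
  have vb: "v \<in> boundary G (set (xs i))" using step(1) IH by blast
  have cost: "travel_cost (explore_step \<epsilon>) G w f r (Suc i) = travel_cost (explore_step \<epsilon>) G w f r i
      + graph_dist (observed_graph G (set (xs i))) w (last (xs i)) v"
    by (simp add: travel_cost_def position_def xs_def v_def)
  have "travel_cost (explore_step \<epsilon>) G w f r (Suc i) + graph_dist G w v g \<le>
      graph_dist G w r g + real (Suc i) * (\<epsilon> * (2 / (1 - \<epsilon>)) * graph_dist G w r g)"
  proof -
    define K where "K = \<epsilon> * (2 / (1 - \<epsilon>)) * graph_dist G w r g"
    have "graph_dist (observed_graph G (set (xs i))) w (last (xs i)) v \<le>
        graph_dist G w (last (xs i)) g - graph_dist G w v g + K"
      using step(2) IH by (simp only: K_def)
    moreover have "travel_cost (explore_step \<epsilon>) G w f r i + graph_dist G w (last (xs i)) g \<le>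
        graph_dist G w r g + real i * K"
      using IH by (simp only: K_def)
    ultimately show ?thesis unfolding cost of_nat_Suc distrib_right K_def[symmetric] by linarith
  qed
  moreover have "v \<notin> set (xs i)" using vb by (simp add: boundary_def)
  ultimately show ?case using IH vb ne path_closed_insert[OF _ vb]
    unfolding Suc_xs by (auto simp: less_Suc_eq Suc_xs)
qed

lemma explore_step_finds_goal:
  assumes r: "r \<in> pverts G"
  obtains T where "finds_goal_at (explore_step \<epsilon>) G w f r g T" "T \<le> card (pverts G)"
    "travel_cost (explore_step \<epsilon>) G w f r T
      \<le> graph_dist G w r g + real T * (\<epsilon> * (2 / (1 - \<epsilon>)) * graph_dist G w r g)"
proof -
  define xs where "xs = visits (explore_step \<epsilon>) G w f r"
  note inv = visits_before_goal[OF r, folded xs_def]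
  have len: "Suc i \<le> card (pverts G)" if "\<And>j. j < i \<Longrightarrow> g \<notin> set (xs j)" for i
    using inv[OF that] distinct_card[of "xs i"] path_closed_subset[of "set (xs i)"]
      card_mono[OF pair_finite_verts, of "set (xs i)"] by auto
  \<comment> \<open>If \<open>g\<close> were never visited, iteration \<open>card (pverts G)\<close>
    would have one more distinct visited vertex than the tree has vertices.\<close>
  have ex: "\<exists>i. g \<in> set (xs i)"
    using len[of "card (pverts G)"] by (meson Suc_n_not_le_n)
  define T where "T = (LEAST i. g \<in> set (xs i))"
  have T: "g \<in> set (xs T)" unfolding T_def using ex by (rule LeastI_ex)
  have before: "g \<notin> set (xs j)" if "j < T" for j
    using that not_less_Least unfolding T_def by blast
  have ne: "xs i \<noteq> []" for i by (cases i) (simp_all add: xs_def)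
  have last: "last (xs T) = g"
  proof (cases T)
    case 0
    then show ?thesis using T by (simp add: xs_def)
  next
    case (Suc i)
    then show ?thesis using T before[of i] by (simp add: xs_def)
  qed
  have "finds_goal_at (explore_step \<epsilon>) G w f r g T"
    unfolding finds_goal_at_def position_def xs_def[symmetric]
    using last before inv[of T] last_in_set[OF ne] by metis
  moreover have "T \<le> card (pverts G)" using len[of T] before by simp
  moreover have "travel_cost (explore_step \<epsilon>) G w f r T
      \<le> graph_dist G w r g + real T * (\<epsilon> * (2 / (1 - \<epsilon>)) * graph_dist G w r g)"
    using inv[of T] before last graph_dist_nonneg[OF goal goal] by auto
  ultimately show thesis using that by blast
qed

end

section \<open>Comparison with the claimed bounds\<close>

theorem theorem2:
  fixes \<epsilon> :: real
  assumes "0 < \<epsilon>" and "\<epsilon> < 1"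
  shows "\<exists>A :: 'a algorithm.
    \<forall>(G :: 'a pair_pre_digraph) (w :: 'a \<times> 'a \<Rightarrow> real) (f :: 'a \<Rightarrow> real) (r :: 'a) (g :: 'a).
      weighted_tree G w \<longrightarrow> r \<in> pverts G \<longrightarrow> g \<in> pverts G \<longrightarrow>
      (\<forall>v \<in> pverts G. (1 - \<epsilon>) * graph_dist G w v g \<le> f v \<and>
                       f v \<le> (1 + \<epsilon>) * graph_dist G w v g) \<longrightarrow>
      (\<exists>T. finds_goal_at A G w f r g T \<and>
        travel_cost A G w f r T
          \<le> (1 / (1 - \<epsilon>) + real (card (pverts G)) * \<epsilon> * (4 / (1 - \<epsilon>)\<^sup>2)) * graph_dist G w r g \<and>
        ((\<forall>v \<in> pverts G. f v \<le> graph_dist G w v g) \<longrightarrow>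
          travel_cost A G w f r T
            \<le> (1 + real (card (pverts G)) * \<epsilon> * (2 / (1 - \<epsilon>))) * graph_dist G w r g))"
proof (intro exI[of _ "explore_step \<epsilon>"] allI impI)
  fix G :: "'a pair_pre_digraph" and w f r g
  assume tree: "weighted_tree G w" and r: "r \<in> pverts G" and g: "g \<in> pverts G"
    and pred: "\<forall>v \<in> pverts G. (1 - \<epsilon>) * graph_dist G w v g \<le> f v \<and>
      f v \<le> (1 + \<epsilon>) * graph_dist G w v g"
  interpret weighted_tree G w by fact
  interpret tree_search G w \<epsilon> f g
    using assms g pred by unfold_locales auto
  let ?n = "real (card (pverts G))" and ?D = "graph_dist G w r g"
  obtain T where T: "finds_goal_at (explore_step \<epsilon>) G w f r g T" "T \<le> card (pverts G)"
    "travel_cost (explore_step \<epsilon>) G w f r T \<le> ?D + real T * (\<epsilon> * (2 / (1 - \<epsilon>)) * ?D)"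
    using explore_step_finds_goal[OF r] .
  have D: "0 \<le> ?D" by (rule graph_dist_nonneg[OF r g])
  have "real T * (\<epsilon> * (2 / (1 - \<epsilon>)) * ?D) \<le> ?n * (\<epsilon> * (2 / (1 - \<epsilon>)) * ?D)"
    using T(2) D assms by (intro mult_right_mono) auto
  then have bound: "travel_cost (explore_step \<epsilon>) G w f r T \<le> (1 + ?n * \<epsilon> * (2 / (1 - \<epsilon>))) * ?D"
    using T(3) by (simp add: algebra_simps)
  have "1 \<le> 1 / (1 - \<epsilon>)" using assms by simp
  \<comment> \<open>Over the common denominator the comparison becomes
    \<open>2 * (1 - \<epsilon>) \<le> 4\<close>.\<close>
  moreover have "2 / (1 - \<epsilon>) = 2 * (1 - \<epsilon>) / (1 - \<epsilon>)\<^sup>2"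
    using assms unfolding power2_eq_square by (subst mult_divide_mult_cancel_right) auto
  then have "2 / (1 - \<epsilon>) \<le> 4 / (1 - \<epsilon>)\<^sup>2"
    using assms by (simp add: divide_right_mono)
  then have "?n * \<epsilon> * (2 / (1 - \<epsilon>)) \<le> ?n * \<epsilon> * (4 / (1 - \<epsilon>)\<^sup>2)"
    using assms by (intro mult_left_mono) auto
  ultimately have "(1 + ?n * \<epsilon> * (2 / (1 - \<epsilon>))) * ?D
      \<le> (1 / (1 - \<epsilon>) + ?n * \<epsilon> * (4 / (1 - \<epsilon>)\<^sup>2)) * ?D"
    using D by (intro mult_right_mono add_mono)
  then show "\<exists>T. finds_goal_at (explore_step \<epsilon>) G w f r g T \<and>
      travel_cost (explore_step \<epsilon>) G w f r T
        \<le> (1 / (1 - \<epsilon>) + ?n * \<epsilon> * (4 / (1 - \<epsilon>)\<^sup>2)) * ?D \<and>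
      ((\<forall>v \<in> pverts G. f v \<le> graph_dist G w v g) \<longrightarrow>
        travel_cost (explore_step \<epsilon>) G w f r T \<le> (1 + ?n * \<epsilon> * (2 / (1 - \<epsilon>))) * ?D)"
    using T(1) bound by (intro exI[of _ T]) auto
qed

end
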